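(* For each $k\ge1$ let $T_k$ be the tree defined recursively by $T_1=K_1$ (with its single vertex as root) and, for $k\ge2$, $T_k$ is obtained from two disjoint copies of $T_{k-1}$ by adding an edge between their roots, the root of $T_k$ being the root of one of the copies. Then $$\lim_{k\to\infty}\bigl(\Gamma(T_k)-z(T_k)\bigr)=+\infty.$$
   Context: $T_k$ has $2^{k-1}$ vertices and is the unique smallest tree with Grundy number $k$. A proper coloring with colors $1,\dots,k$ is a Grundy coloring if for any $i<j$, every vertex of color $j$ has a neighbor of color $i$; $\Gamma(G)$ is the maximum number of colors in a Grundy coloring of $G$. A vertex of color $i$ is color-dominating if it has a neighbor of every other color $j\neq i$ used. A $z$-coloring is a proper coloring using $k$ colors which is a Grundy coloring, in which every color class contains a color-dominating vertex, and which contains color-dominating vertices $u_1,\dots,u_k$ with $u_j$ of color $j$ and $u_k$ adjacent to $u_j$ for every $j\neq k$. $z(G)$ is the maximum number of colors in a $z$-coloring of $G$. *)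

theory Defs
  imports Complex_Main "Graph_Theory.Pair_Digraph"
begin

text \<open>
  Finite simple graphs are the digraphs satisfying the locale \<open>pair_graph\<close>: finite, loop-free, and
  with every edge represented by its two opposite arcs.
\<close>

text \<open>
  The condition \<open>c ` pverts G = {1..k}\<close> says that all of the colours \<open>1, \<dots>, k\<close> are used,
  so that \<open>k\<close> really is the number of colours.
\<close>

definition proper_coloring :: "'a pair_pre_digraph \<Rightarrow> nat \<Rightarrow> ('a \<Rightarrow> nat) \<Rightarrow> bool" where
  "proper_coloring G k c \<longleftrightarrow>
     c ` pverts G = {1..k} \<and> (\<forall>u v. (u, v) \<in> parcs G \<longrightarrow> c u \<noteq> c v)"

definition grundy_coloring :: "'a pair_pre_digraph \<Rightarrow> nat \<Rightarrow> ('a \<Rightarrow> nat) \<Rightarrow> bool" where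
  "grundy_coloring G k c \<longleftrightarrow>
     proper_coloring G k c \<and>
     (\<forall>i\<in>{1..k}. \<forall>j\<in>{1..k}. i < j \<longrightarrow>
        (\<forall>v\<in>pverts G. c v = j \<longrightarrow> (\<exists>w\<in>pverts G. (v, w) \<in> parcs G \<and> c w = i)))"

definition color_dominating :: "'a pair_pre_digraph \<Rightarrow> nat \<Rightarrow> ('a \<Rightarrow> nat) \<Rightarrow> 'a \<Rightarrow> bool" where
  "color_dominating G k c v \<longleftrightarrow>
     v \<in> pverts G \<and>
     (\<forall>j\<in>{1..k}. j \<noteq> c v \<longrightarrow> (\<exists>w\<in>pverts G. (v, w) \<in> parcs G \<and> c w = j))"

definition z_coloring :: "'a pair_pre_digraph \<Rightarrow> nat \<Rightarrow> ('a \<Rightarrow> nat) \<Rightarrow> bool" where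
  "z_coloring G k c \<longleftrightarrow>
     grundy_coloring G k c \<and>
     (\<forall>j\<in>{1..k}. \<exists>v. color_dominating G k c v \<and> c v = j) \<and>
     (\<exists>u. (\<forall>j\<in>{1..k}. color_dominating G k c (u j) \<and> c (u j) = j) \<and>
          (\<forall>j\<in>{1..k}. j \<noteq> k \<longrightarrow> (u k, u j) \<in> parcs G))"

definition grundy_number :: "'a pair_pre_digraph \<Rightarrow> nat" where
  "grundy_number G = Max {k. \<exists>c. grundy_coloring G k c}"

definition z_number :: "'a pair_pre_digraph \<Rightarrow> nat" where
  "z_number G = Max {k. \<exists>c. z_coloring G k c}"

text \<open>
  The two disjoint copies of the tree \<open>T\<^sub>k\<close> inside \<open>T\<^sub>k\<^sub>+\<^sub>1\<close> are told apart by prefixing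
  the names of their vertices with \<open>False\<close> and \<open>True\<close>; the new root is the root of the
  \<open>False\<close> copy. The trees are indexed from 1, and the values at index 0 are junk.
\<close>

fun grundy_root :: "nat \<Rightarrow> bool list" where
  "grundy_root 0 = []"
| "grundy_root (Suc 0) = []"
| "grundy_root (Suc (Suc k)) = False # grundy_root (Suc k)"

fun grundy_tree :: "nat \<Rightarrow> bool list pair_pre_digraph" where
  "grundy_tree 0 = \<lparr> pverts = {}, parcs = {} \<rparr>"
| "grundy_tree (Suc 0) = \<lparr> pverts = {[]}, parcs = {} \<rparr>"
| "grundy_tree (Suc (Suc k)) =
     (let T = grundy_tree (Suc k); r = grundy_root (Suc k) in
      \<lparr> pverts = {b # v | b v. v \<in> pverts T},
        parcs = {(b # u, b # v) | b u v. (u, v) \<in> parcs T} \<union>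
                {(False # r, True # r), (True # r, False # r)} \<rparr>)"

declare grundy_tree.simps(3) [simp del]

lemma grundy_tree_arc_iff:
  "(x, y) \<in> parcs (grundy_tree (Suc (Suc k))) \<longleftrightarrow>
     (\<exists>b u v. x = b # u \<and> y = b # v \<and> (u, v) \<in> parcs (grundy_tree (Suc k))) \<or>
     (\<exists>b. x = b # grundy_root (Suc k) \<and> y = (\<not> b) # grundy_root (Suc k))"
  by (auto simp: grundy_tree.simps(3) Let_def ex_bool_eq)

lemma grundy_tree_vert_iff:
  "x \<in> pverts (grundy_tree (Suc (Suc k))) \<longleftrightarrow>
     (\<exists>b v. x = b # v \<and> v \<in> pverts (grundy_tree (Suc k)))"
  by (auto simp: grundy_tree.simps(3) Let_def)

lemma grundy_root_in_tree: "grundy_root (Suc k) \<in> pverts (grundy_tree (Suc k))"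
  by (induction k) (auto simp: grundy_tree_vert_iff)

lemma grundy_tree_verts: "pverts (grundy_tree (Suc k)) = {xs. length xs = k}"
proof (induction k)
  case (Suc k)
  then show ?case by (auto simp: grundy_tree_vert_iff length_Suc_conv)
qed auto

lemma card_grundy_tree: "card (pverts (grundy_tree (Suc k))) = 2 ^ k"
  using card_lists_length_eq[of "UNIV :: bool set" k] by (simp add: grundy_tree_verts)

lemma pair_graph_grundy_tree: "pair_graph (grundy_tree (Suc k))"
proof -
  have arcs: "u \<in> pverts (grundy_tree (Suc k)) \<and> v \<in> pverts (grundy_tree (Suc k)) \<and>
      u \<noteq> v \<and> (v, u) \<in> parcs (grundy_tree (Suc k))"
    if "(u, v) \<in> parcs (grundy_tree (Suc k))" for u v
    using that
  proof (induction k arbitrary: u v)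
    case (Suc k)
    from Suc.prems consider
        (copy) b u' v' where "u = b # u'" "v = b # v'" "(u', v') \<in> parcs (grundy_tree (Suc k))"
      | (root) b where "u = b # grundy_root (Suc k)" "v = (\<not> b) # grundy_root (Suc k)"
      unfolding grundy_tree_arc_iff by blast
    then show ?case
    proof cases
      case copy
      then show ?thesis using Suc.IH[OF copy(3)]
        unfolding grundy_tree_arc_iff grundy_tree_vert_iff by blast
    next
      case root
      then show ?thesis using grundy_root_in_tree[of k]
        unfolding grundy_tree_arc_iff grundy_tree_vert_iff by blast
    qed
  qed auto
  have fin: "finite (pverts (grundy_tree (Suc k)))"
    using card_grundy_tree[of k] by (intro card_ge_0_finite) simp
  have "parcs (grundy_tree (Suc k)) \<subseteq> pverts (grundy_tree (Suc k)) \<times> pverts (grundy_tree (Suc k))"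
    using arcs by auto
  then have "finite (parcs (grundy_tree (Suc k)))"
    using fin by (meson finite_SigmaI finite_subset)
  then show ?thesis
    using arcs fin by unfold_locales (auto simp: symmetric_def sym_def)
qed

text \<open>The maxima defining \<open>\<Gamma>(T\<^sub>k)\<close> and \<open>z(T\<^sub>k)\<close> are taken over finite nonempty sets.\<close>

lemma finite_grundy_coloring_numbers:
  assumes "finite (pverts G)"
  shows "finite {k. \<exists>c. grundy_coloring G k c}"
proof -
  have "k \<le> card (pverts G)" if "grundy_coloring G k c" for k c
    using that card_image_le[OF assms, of c]
    by (simp add: grundy_coloring_def proper_coloring_def)
  then have "{k. \<exists>c. grundy_coloring G k c} \<subseteq> {..card (pverts G)}" by blast
  then show ?thesis by (rule finite_subset) (rule finite_atMost)
qed

lemma finite_z_coloring_numbers: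
  assumes "finite (pverts G)"
  shows "finite {k. \<exists>c. z_coloring G k c}"
  by (rule finite_subset[OF _ finite_grundy_coloring_numbers[OF assms]])
     (auto simp: z_coloring_def)

lemma z_coloring_grundy_tree_exists: "\<exists>k c. z_coloring (grundy_tree (Suc n)) k c"
proof (cases n)
  case 0
  have "z_coloring (grundy_tree (Suc 0)) 1 (\<lambda>_. 1)"
    unfolding z_coloring_def grundy_coloring_def proper_coloring_def color_dominating_def
    by auto
  then show ?thesis using 0 by blast
next
  case (Suc m)
  let ?T = "grundy_tree (Suc (Suc m))" and ?r = "grundy_root (Suc m)"
  define c where "c v = (if even (length (filter id v)) then 1 else 2 :: nat)" for v :: "bool list"
  have V: "c v \<in> {1, 2}" for v by (auto simp: c_def)
  have "even (length (filter id u)) \<noteq> even (length (filter id v))"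
    if "(u, v) \<in> parcs (grundy_tree (Suc k))" for k u v
    using that
  proof (induction k arbitrary: u v)
    case (Suc k)
    from Suc.prems consider
        (copy) b u' v' where "u = b # u'" "v = b # v'" "(u', v') \<in> parcs (grundy_tree (Suc k))"
      | (root) b where "u = b # grundy_root (Suc k)" "v = (\<not> b) # grundy_root (Suc k)"
      unfolding grundy_tree_arc_iff by blast
    then show ?case
    proof cases
      case copy
      then show ?thesis using Suc.IH[OF copy(3)] by (cases b) auto
    next
      case root
      then show ?thesis by (cases b) auto
    qed
  qed auto
  then have proper: "c u \<noteq> c v" if "(u, v) \<in> parcs (grundy_tree (Suc k))" for k u v
    using that by (fastforce simp: c_def)
  have nbr: "\<exists>w. (v, w) \<in> parcs (grundy_tree (Suc (Suc k)))"
    if "v \<in> pverts (grundy_tree (Suc (Suc k)))" for k v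
    using that
  proof (induction k arbitrary: v)
    case 0
    then obtain b where "v = [b]" by (auto simp: grundy_tree_vert_iff)
    then show ?case by (auto simp: grundy_tree_arc_iff)
  next
    case (Suc k)
    then obtain b u where v: "v = b # u" "u \<in> pverts (grundy_tree (Suc (Suc k)))"
      unfolding grundy_tree_vert_iff[of v "Suc k"] by blast
    then obtain w where "(u, w) \<in> parcs (grundy_tree (Suc (Suc k)))" using Suc.IH by blast
    then have "(v, b # w) \<in> parcs (grundy_tree (Suc (Suc (Suc k))))"
      unfolding grundy_tree_arc_iff[of _ _ "Suc k"] using v by blast
    then show ?case by blast
  qed
  interpret pair_graph ?T by (rule pair_graph_grundy_tree)
  have edge: "(False # ?r, True # ?r) \<in> parcs ?T" "(True # ?r, False # ?r) \<in> parcs ?T"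
    unfolding grundy_tree_arc_iff by auto
  have cdom: "\<exists>w\<in>pverts ?T. (v, w) \<in> parcs ?T \<and> c w = j"
    if v: "v \<in> pverts ?T" and j: "j \<in> {1..2}" "j \<noteq> c v" for v j
  proof -
    obtain w where w: "(v, w) \<in> parcs ?T" using nbr v by blast
    have "c w \<noteq> c v" using proper[OF w] by simp
    then have "c w = j" using j V[of v] V[of w] by auto
    then show ?thesis using w in_arcsD2 by blast
  qed
  define u where "u j = (if c (False # ?r) = j then False # ?r else True # ?r)" for j :: nat
  have ne: "c (False # ?r) \<noteq> c (True # ?r)" using proper[OF edge(1)] .
  have u: "c (u j) = j" "u j \<in> pverts ?T" if "j \<in> {1..2}" for j
  proof -
    show "c (u j) = j" using ne that V[of "False # ?r"] V[of "True # ?r"]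
      by (auto simp: u_def)
    show "u j \<in> pverts ?T" unfolding u_def using edge[THEN in_arcsD1] by simp
  qed
  have u21: "(u 2, u 1) \<in> parcs ?T"
    using edge ne V[of "False # ?r"] V[of "True # ?r"] by (auto simp: u_def)
  have img: "c ` pverts ?T = {1..2}"
  proof
    show "c ` pverts ?T \<subseteq> {1..2}"
    proof (intro image_subsetI)
      fix v show "c v \<in> {1..2}" using V[of v] by auto
    qed
    show "{1..2} \<subseteq> c ` pverts ?T" using u by (metis imageI subsetI)
  qed
  have dom: "color_dominating ?T 2 c v" if "v \<in> pverts ?T" for v
    unfolding color_dominating_def using that cdom by blast
  have "proper_coloring ?T 2 c"
    unfolding proper_coloring_def using img proper by blast
  then have "grundy_coloring ?T 2 c"
    unfolding grundy_coloring_def using cdom by blast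
  moreover have "\<forall>j\<in>{1..2}. color_dominating ?T 2 c (u j) \<and> c (u j) = j"
    using u(1) dom[OF u(2)] by auto
  moreover have "\<forall>j\<in>{1..2}. j \<noteq> 2 \<longrightarrow> (u 2, u j) \<in> parcs ?T"
  proof (intro ballI impI)
    fix j :: nat assume "j \<in> {1..2}" "j \<noteq> 2"
    then have "j = 1" by auto
    then show "(u 2, u j) \<in> parcs ?T" using u21 by simp
  qed
  ultimately have "z_coloring ?T 2 c" unfolding z_coloring_def by blast
  then show ?thesis using Suc by blast
qed

lemma grundy_coloring_grundy_tree_exists: "\<exists>k c. grundy_coloring (grundy_tree (Suc n)) k c"
  using z_coloring_grundy_tree_exists[of n] unfolding z_coloring_def by blast

end

theory Submission
  imports Defs
begin

text \<open>
  In a \<open>z\<close>-colouring with \<open>m\<close> colours some vertex has \<open>m - 1\<close> neighbours of degree at least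
  \<open>m - 1\<close>. In \<open>T\<^sub>k\<close> the children of a vertex have pairwise distinct degrees, all of them less than \<open>k\<close>,
  so that at most about \<open>k - m\<close> neighbours can have such a degree; hence \<open>2m \<le> k + 3\<close>.
  On the other hand \<open>\<Gamma>(T\<^sub>k) \<ge> k\<close>: colour each vertex by one plus its number of children.
\<close>

lemma grundy_root_eq_replicate: "grundy_root (Suc k) = replicate k False"
  by (induction k) auto

text \<open>Each edge arises at one level of the recursion: the prefix \<open>us\<close> names a
  copy of \<open>T_{j+2}\<close>, and the edge joins the roots of its two halves. The end with the
  bit \<open>False\<close> is the parent, as the root of the whole tree is all
  \<open>False\<close>.\<close>

lemma grundy_tree_arc_iff_append:
  "(x, y) \<in> parcs (grundy_tree (Suc n)) \<longleftrightarrow>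
     (\<exists>us b j. x = us @ b # replicate j False \<and> y = us @ (\<not> b) # replicate j False \<and>
        length us + j + 1 = n)"
proof (induction n arbitrary: x y)
  case 0
  then show ?case by simp
next
  case (Suc n)
  show ?case (is "_ = ?R (Suc n) x y")
  proof
    assume "(x, y) \<in> parcs (grundy_tree (Suc (Suc n)))"
    then consider (copy) b u v where "x = b # u" "y = b # v" "(u, v) \<in> parcs (grundy_tree (Suc n))"
      | (root) b where "x = b # replicate n False" "y = (\<not> b) # replicate n False"
      unfolding grundy_tree_arc_iff grundy_root_eq_replicate by blast
    then show "?R (Suc n) x y"
    proof cases
      case copy
      then obtain us a j where "u = us @ a # replicate j False" "v = us @ (\<not> a) # replicate j False"
          "length us + j + 1 = n"
        using Suc.IH by blast
      with copy show ?thesis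
        by (intro exI[of _ "b # us"] exI[of _ a] exI[of _ j]) simp
    next
      case root
      then show ?thesis
        by (intro exI[of _ "[]"] exI[of _ b] exI[of _ n]) simp
    qed
  next
    assume "?R (Suc n) x y"
    then obtain us b j where *: "x = us @ b # replicate j False" "y = us @ (\<not> b) # replicate j False"
        "length us + j + 1 = Suc n"
      by blast
    show "(x, y) \<in> parcs (grundy_tree (Suc (Suc n)))"
    proof (cases us)
      case Nil
      with * show ?thesis unfolding grundy_tree_arc_iff grundy_root_eq_replicate by auto
    next
      case (Cons a us')
      with * have "?R n (us' @ b # replicate j False) (us' @ (\<not> b) # replicate j False)"
        by auto
      with * Cons show ?thesis unfolding grundy_tree_arc_iff Suc.IH by auto
    qed
  qed
qed

text \<open>The number of children of \<open>x\<close>: the child number \<open>j\<close> sets the bit in front of the last \<open>j\<close> bits.\<close>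

definition trailing :: "bool list \<Rightarrow> nat" where
  "trailing x = length (takeWhile Not (rev x))"

text \<open>Positions count from the end, so \<open>flip x j\<close> is the only possible neighbour
  of \<open>x\<close> along an edge at position \<open>j\<close>: a child for
  \<open>j < trailing x\<close>, the parent for \<open>j = trailing x\<close> if \<open>x\<close>
  contains a \<open>True\<close>.\<close>

definition flip :: "bool list \<Rightarrow> nat \<Rightarrow> bool list" where
  "flip x j = x[length x - Suc j := \<not> x ! (length x - Suc j)]"

lemma trailing_append_True: "trailing (us @ True # replicate j False) = j"
  by (simp add: trailing_def takeWhile_append)

lemma trailing_append_ge: "j \<le> trailing (us @ b # replicate j False)"
  by (simp add: trailing_def takeWhile_append)

lemma trailing_append_False: "j < trailing (us @ False # replicate j False)"
  by (simp add: trailing_def takeWhile_append)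

lemma trailing_le_length: "trailing x \<le> length x"
  using length_takeWhile_le[of Not "rev x"] by (simp add: trailing_def)

lemma trailing_replicate_False: "trailing (replicate n False) = n"
  by (simp add: trailing_def takeWhile_eq_all_conv[THEN iffD2])

text \<open>This exhibits \<open>x\<close> as the parent end of an edge at position
  \<open>j\<close>, the form in which \<open>grundy_tree_arc_iff_append\<close> applies.\<close>

lemma less_trailing_obtain:
  assumes "j < trailing x"
  obtains us where "x = us @ False # replicate j False"
proof -
  let ?t = "takeWhile Not (rev x)"
  have "?t = replicate (length ?t) False"
    by (rule replicate_eqI) (auto dest: set_takeWhileD)
  then have "rev x = replicate (trailing x) False @ dropWhile Not (rev x)"
    unfolding trailing_def by (metis takeWhile_dropWhile_id)
  then have "x = rev (dropWhile Not (rev x)) @ replicate (trailing x) False"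
    by (metis rev_append rev_replicate rev_rev_ident)
  moreover have "replicate (trailing x) False =
      replicate (trailing x - Suc j) False @ False # replicate j False"
    using assms by (simp flip: replicate_Suc replicate_add)
  ultimately show ?thesis using that by (metis append.assoc)
qed

lemma flip_append: "flip (us @ b # replicate j False) j = us @ (\<not> b) # replicate j False"
  by (simp add: flip_def)

lemma grundy_tree_neighbours_subset:
  "parcs (grundy_tree (Suc n)) `` {x} \<subseteq> flip x ` {..trailing x}"
proof
  fix y assume "y \<in> parcs (grundy_tree (Suc n)) `` {x}"
  then obtain us b j where *: "x = us @ b # replicate j False" "y = us @ (\<not> b) # replicate j False"
    by (auto simp: grundy_tree_arc_iff_append)
  then have "y = flip x j" by (simp add: flip_append)
  with * show "y \<in> flip x ` {..trailing x}" using trailing_append_ge by blast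
qed

lemma grundy_tree_finite_neighbours: "finite (parcs (grundy_tree (Suc n)) `` {x})"
  by (rule finite_subset[OF grundy_tree_neighbours_subset]) simp

lemma grundy_tree_degree_le: "card (parcs (grundy_tree (Suc n)) `` {x}) \<le> Suc (trailing x)"
  using surj_card_le[OF _ grundy_tree_neighbours_subset[of n x]] by simp

text \<open>The parent of \<open>v\<close> may have any degree and accounts for the
  \<open>Suc\<close>. The child at position \<open>j\<close> has \<open>j\<close> children, so
  degree at most \<open>j + 1\<close>; hence a heavy child has
  \<open>d - 1 \<le> j < n\<close>.\<close>

lemma grundy_tree_card_heavy_neighbours:
  "card {w \<in> parcs (grundy_tree (Suc n)) `` {v}. d \<le> card (parcs (grundy_tree (Suc n)) `` {w})}
     \<le> Suc (n - (d - 1))"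
  (is "card ?H \<le> _")
proof -
  have "?H \<subseteq> insert (flip v (trailing v)) (flip v ` {d - 1..<n})"
  proof
    fix w assume w: "w \<in> ?H"
    then obtain us b j where *: "v = us @ b # replicate j False" "w = us @ (\<not> b) # replicate j False"
        "length us + j + 1 = n"
      by (auto simp: grundy_tree_arc_iff_append)
    then have flip: "w = flip v j" by (simp add: flip_append)
    show "w \<in> insert (flip v (trailing v)) (flip v ` {d - 1..<n})"
    \<comment> \<open>If \<open>b\<close> is true, \<open>w\<close> is the parent of
      \<open>v\<close>; otherwise \<open>w\<close> is a child.\<close>
    proof (cases b)
      case True
      then show ?thesis using * flip by (simp add: trailing_append_True)
    next
      case False
      then have "trailing w = j" using * by (simp add: trailing_append_True)
      then have "d \<le> Suc j" using w grundy_tree_degree_le[of n w] by simp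
      then have "j \<in> {d - 1..<n}" using * by auto
      then show ?thesis using flip by blast
    qed
  qed
  then have "card ?H \<le> card (insert (flip v (trailing v)) (flip v ` {d - 1..<n}))"
    by (intro card_mono) auto
  also have "\<dots> \<le> Suc (card (flip v ` {d - 1..<n}))"
    by (rule card_insert_le_m1) auto
  also have "\<dots> \<le> Suc (n - (d - 1))"
    using card_image_le[of "{d - 1..<n}" "flip v"] by simp
  finally show ?thesis .
qed

text \<open>The \<open>k - 1\<close> colours other than \<open>c v\<close> all occur among the
  neighbours. Finiteness matters because \<open>card\<close> is 0 on infinite sets.\<close>

lemma color_dominating_degree_ge:
  assumes "color_dominating G k c v" "c v \<in> {1..k}" "finite (parcs G `` {v})"
  shows "k - 1 \<le> card (parcs G `` {v})"
proof -
  have "{1..k} - {c v} \<subseteq> c ` (parcs G `` {v})"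
    using assms(1) by (auto simp: color_dominating_def)
  from surj_card_le[OF assms(3) this] show ?thesis using assms(2) by simp
qed

lemma z_coloring_grundy_tree_le:
  assumes "z_coloring (grundy_tree (Suc n)) m c"
  shows "2 * m \<le> n + 4"
proof (cases "m = 0")
  case False
  let ?A = "parcs (grundy_tree (Suc n))"
  obtain u where u: "\<And>j. j \<in> {1..m} \<Longrightarrow> color_dominating (grundy_tree (Suc n)) m c (u j)"
      "\<And>j. j \<in> {1..m} \<Longrightarrow> c (u j) = j" "\<And>j. j \<in> {1..m} \<Longrightarrow> j \<noteq> m \<Longrightarrow> (u m, u j) \<in> ?A"
    using assms unfolding z_coloring_def by blast
  have sub: "u ` {1..<m} \<subseteq> {w \<in> ?A `` {u m}. m - 1 \<le> card (?A `` {w})}" (is "_ \<subseteq> ?H")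
  proof
    fix w assume "w \<in> u ` {1..<m}"
    then obtain j where j: "w = u j" "j \<in> {1..m}" "j \<noteq> m" by auto
    then have "m - 1 \<le> card (?A `` {w})"
      using u(2)[of j] color_dominating_degree_ge[OF u(1) _ grundy_tree_finite_neighbours] by simp
    then show "w \<in> ?H" using u(3)[of j] j by simp
  qed
  \<comment> \<open>The \<open>u j\<close> are distinct because their colours are: \<open>c\<close>
    is a left inverse of \<open>u\<close>.\<close>
  have "inj_on u {1..<m}"
    by (rule inj_on_inverseI[of _ c]) (simp add: u(2))
  then have "m - 1 = card (u ` {1..<m})" by (simp add: card_image)
  also have "\<dots> \<le> card ?H"
    by (intro card_mono sub finite_subset[OF _ grundy_tree_finite_neighbours[of n "u m"]]) blast
  also have "\<dots> \<le> Suc (n - (m - 1 - 1))" by (rule grundy_tree_card_heavy_neighbours)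
  \<comment> \<open>Truncated subtraction is harmless: if \<open>m - 2\<close> exceeded
    \<open>n\<close>, the bound would read \<open>m - 1 \<le> 1\<close>, which is impossible for
    such \<open>m\<close>.\<close>
  finally show ?thesis by linarith
qed simp

text \<open>Child number \<open>i\<close> has exactly \<open>i\<close> children, so the children of
  a vertex carry precisely the colours below its own.\<close>

lemma grundy_coloring_trailing: "grundy_coloring (grundy_tree (Suc n)) (Suc n) (\<lambda>x. Suc (trailing x))"
proof -
  let ?T = "grundy_tree (Suc n)"
  have "trailing ` pverts ?T = {..n}"
  proof
    show "trailing ` pverts ?T \<subseteq> {..n}"
      using trailing_le_length by (auto simp: grundy_tree_verts)
    show "{..n} \<subseteq> trailing ` pverts ?T"
    proof
      fix j assume "j \<in> {..n}"
      show "j \<in> trailing ` pverts ?T"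
      \<comment> \<open>Only the root has \<open>n\<close> trailing \<open>False\<close> bits. For
        smaller \<open>j\<close> a \<open>True\<close> precedes them, and the padding in front of it
        is arbitrary.\<close>
      proof (cases "j = n")
        case True
        then show ?thesis
          by (intro image_eqI[of _ _ "replicate n False"])
             (simp_all add: grundy_tree_verts trailing_replicate_False)
      next
        case False
        then show ?thesis using \<open>j \<in> {..n}\<close>
          by (intro image_eqI[of _ _ "replicate (n - 1 - j) True @ True # replicate j False"])
             (simp_all only: trailing_append_True, auto simp: grundy_tree_verts)
      qed
    qed
  qed
  then have "(\<lambda>x. Suc (trailing x)) ` pverts ?T = Suc ` {0..n}"
    by (simp flip: image_image add: atLeast0AtMost)
  then have img: "(\<lambda>x. Suc (trailing x)) ` pverts ?T = {1..Suc n}"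
    by (simp add: image_Suc_atLeastAtMost)
  have proper: "trailing x \<noteq> trailing y" if arc: "(x, y) \<in> parcs ?T" for x y
  proof -
    obtain us b j where "x = us @ b # replicate j False" "y = us @ (\<not> b) # replicate j False"
      using arc unfolding grundy_tree_arc_iff_append by blast
    \<comment> \<open>The \<open>True\<close> end has exactly \<open>j\<close> trailing
      \<open>False\<close> bits, the other end more.\<close>
    then show ?thesis
      using trailing_append_True[of us j] trailing_append_False[of j us] by (cases b) auto
  qed
  have "\<exists>w\<in>pverts ?T. (v, w) \<in> parcs ?T \<and> Suc (trailing w) = i"
    if v: "v \<in> pverts ?T" and i: "1 \<le> i" "i < Suc (trailing v)" for i v
  proof -
    have "i - 1 < trailing v" using i by simp
    then obtain us where us: "v = us @ False # replicate (i - 1) False"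
      by (rule less_trailing_obtain)
    \<comment> \<open>Child number \<open>i - 1\<close> of \<open>v\<close>; the shift is there
      because colours start at 1.\<close>
    let ?w = "us @ True # replicate (i - 1) False"
    have len: "length us + (i - 1) + 1 = n" using v us by (simp add: grundy_tree_verts)
    then have "?w \<in> pverts ?T" by (simp add: grundy_tree_verts)
    moreover have "(v, ?w) \<in> parcs ?T"
      unfolding grundy_tree_arc_iff_append using us len by fastforce
    moreover have "Suc (trailing ?w) = i" using i by (simp add: trailing_append_True)
    ultimately show ?thesis by blast
  qed
  then show ?thesis
    unfolding grundy_coloring_def proper_coloring_def using img proper by auto
qed

lemma grundy_number_grundy_tree_ge: "k \<le> grundy_number (grundy_tree k)"
proof (cases k)
  case (Suc n)
  interpret pair_graph "grundy_tree (Suc n)" by (rule pair_graph_grundy_tree)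
  show ?thesis
    unfolding grundy_number_def Suc
    using grundy_coloring_trailing
    by (intro Max_ge finite_grundy_coloring_numbers) auto
qed simp

lemma z_number_grundy_tree_le: "2 * z_number (grundy_tree (Suc n)) \<le> n + 4"
proof -
  let ?Z = "{k. \<exists>c. z_coloring (grundy_tree (Suc n)) k c}"
  interpret pair_graph "grundy_tree (Suc n)" by (rule pair_graph_grundy_tree)
  have "Max ?Z \<in> ?Z"
    using z_coloring_grundy_tree_exists[of n]
    by (intro Max_in finite_z_coloring_numbers) auto
  then show ?thesis
    unfolding z_number_def using z_coloring_grundy_tree_le by blast
qed

theorem theorem5:
  shows "filterlim (\<lambda>k. real (grundy_number (grundy_tree k)) - real (z_number (grundy_tree k)))
           at_top sequentially"
proof (rule filterlim_at_top_mono)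
  \<comment> \<open>The minorant is \<open>k - (k + 3) / 2\<close>, from the bounds \<open>k\<close>
    for the Grundy number and \<open>(k + 3) / 2\<close> for the z-number.\<close>
  show "filterlim (\<lambda>k. - 3 / 2 + 1 / 2 * real k) at_top sequentially"
    by (rule filterlim_tendsto_add_at_top[OF tendsto_const],
        rule filterlim_tendsto_pos_mult_at_top[OF tendsto_const _ filterlim_real_sequentially]) simp
  show "\<forall>\<^sub>F k in sequentially. - 3 / 2 + 1 / 2 * real k
      \<le> real (grundy_number (grundy_tree k)) - real (z_number (grundy_tree k))"
    using eventually_gt_at_top[of 0]
  proof eventually_elim
    case (elim k)
    then obtain n where n: "k = Suc n" using gr0_implies_Suc by blast
    then have "k \<le> grundy_number (grundy_tree k)" "2 * z_number (grundy_tree k) \<le> k + 3"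
      using grundy_number_grundy_tree_ge[of k] z_number_grundy_tree_le[of n] by simp_all
    then show ?case by linarith
  qed
qed

end
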